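(* Let $f:\mathbb{R}^n\to\mathbb{R}$ be differentiable with $L$-Lipschitz continuous gradient ($L>0$; convexity is not required), let $s\in\mathbb{N}$, assume $f$ is bounded below on $A_s=\{w\in\mathbb{R}^n:\|w\|_0\le s\}$, and let $\lambda\in(0,L^{-1})$, $\epsilon,\eta,\sigma\in(0,1)$ and $\alpha_{\max}\ge\alpha_{\min}>0$. Then any accumulation point of a sequence $\{w^k\}$ generated by the accelerated projected gradient algorithm by extrapolation (APG, described in the context) is a stationary point of $\min_{w\in A_s}f(w)$.
   Context: Notation. $\|w\|_0$ is the number of nonzero components; $\|\cdot\|$ is the Euclidean norm; $P_C(z)$ is the (possibly set-valued) Euclidean projection onto $C$, i.e. the set of nearest points of $C$ to $z$. $\mathcal{J}_s:=\{J\subseteq\{1,\dots,n\}:|J|=s\}$, $A_J:=\mathrm{span}\{e_j:j\in J\}$, so $A_s=\bigcup_{J\in\mathcal{J}_s}A_J$. For $v\in\mathbb{R}^n$, $v_J$ is the subvector of coordinates indexed by $J$. $T^\lambda_{\mathrm{PG}}(w):=P_{A_s}(w-\lambda\nabla f(w))$. $\nabla^2f(w)$ denotes any element of the generalized Hessian of $f$ at $w$ (the convex hull of limits of Hessians $\nabla^2f(w_i)$ along sequences $w_i\to w$ of points where $\nabla f$ is differentiable). A point $w^*\in A_s$ is a stationary point of $\min_{w\in A_s}f(w)$ if $0\in\nabla f(w^* )+\partial\delta_{A_s}(w^* )$, where $\delta_{A_s}$ is the indicator function of $A_s$ and $\partial$ the limiting subdifferential. Algorithm APG. Start from $w^0\in\mathbb{R}^n$.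 For $k=0,1,2,\dots$: 1. Suppose $k>0$, there is $J\in\mathcal{J}_s$ with $w^{k-1},w^k\in A_J$ ("activate the same $A_J$"), and, with $d^k:=w^k-w^{k-1}$, the quantity $$\zeta_k:=-\frac{\langle d^k,\nabla f(w^k)\rangle}{\|d^k\|\,\|(\nabla f(w^k))_J\|}$$ is well defined and satisfies $\zeta_k\ge\epsilon$. Then compute a trial step by one of the following two formulas: $$\hat t_k=-\frac{\alpha_k\langle\nabla f(w^k),d^k\rangle}{\|d^k\|^2},\ \ \alpha_k:=\frac{\langle s^k,s^k\rangle}{\langle s^k,r^k\rangle},\ s^k:=w^k-w^{k-1},\ r^k:=\nabla f(w^k)-\nabla f(w^{k-1}),$$ or $$\hat t_k=-\frac{\langle\nabla f(w^k),d^k\rangle}{\langle\nabla^2f(w^k)d^k,d^k\rangle}$$ (with $\hat t_k=+\infty$ if the denominator $\langle s^k,r^k\rangle$, respectively $\langle\nabla^2f(w^k)d^k,d^k\rangle$, is zero), and safeguard it by $\hat t_k\leftarrow P_{[c_k\alpha_{\min},\,c_k\alpha_{\max}]}(\hat t_k)$, where $c_k:=\|(\nabla f(w^k))_J\|/(\zeta_k\|d^k\|)$ (so $+\infty$ is mapped to $c_k\alpha_{\max}$). Set $t_k:=\eta^i\hat t_k$ for the smallest integer $i\ge0$ such that $$f(w^k+t_kd^k)\le f(w^k)-\sigma t_k^2\|d^k\|^2,$$ and set $z^k:=w^k+t_kd^k$. 2. Otherwise set $z^k:=w^k$ (no extrapolation). 3. Choose $w^{k+1}\in T^\lambda_{\mathrm{PG}}(z^k)$.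 *)

theory Defs
  imports "HOL-Analysis.Analysis"
begin

section \<open>Gradient and generalized Hessian\<close>

text \<open>Only meaningful at points where f is differentiable.\<close>
definition grad :: "('a::real_inner \<Rightarrow> real) \<Rightarrow> 'a \<Rightarrow> 'a" where
  "grad f x = (THE D. GDERIV f x :> D)"

definition gen_hessian :: "(real^'n \<Rightarrow> real) \<Rightarrow> real^'n \<Rightarrow> (real^'n^'n) set" where
  "gen_hessian f w = convex hull
     {H. \<exists>u Hs. u \<longlonglongrightarrow> w
        \<and> (\<forall>i. (grad f has_derivative (\<lambda>h. Hs i *v h)) (at (u i)))
        \<and> Hs \<longlonglongrightarrow> H}"


section \<open>Limiting subdifferential and stationarity\<close>

text \<open>The Frechet (regular) subdifferential, and the limiting subdifferential built from it;
  both are empty at points where h is not finite.\<close>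

definition regular_subdiff :: "('a::real_inner \<Rightarrow> ereal) \<Rightarrow> 'a \<Rightarrow> 'a set" where
  "regular_subdiff h x = {v. \<bar>h x\<bar> \<noteq> \<infinity>
     \<and> 0 \<le> Liminf (at x) (\<lambda>y. (h y - h x - ereal (v \<bullet> (y - x))) / ereal (norm (y - x)))}"

definition limiting_subdiff :: "('a::real_inner \<Rightarrow> ereal) \<Rightarrow> 'a \<Rightarrow> 'a set" where
  "limiting_subdiff h x = {v. \<bar>h x\<bar> \<noteq> \<infinity>
     \<and> (\<exists>u vs. u \<longlonglongrightarrow> x \<and> (\<lambda>i. h (u i)) \<longlonglongrightarrow> h x
           \<and> (\<forall>i. vs i \<in> regular_subdiff h (u i)) \<and> vs \<longlonglongrightarrow> v)}"

definition indicator_fun :: "'a set \<Rightarrow> 'a \<Rightarrow> ereal" where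
  "indicator_fun C x = (if x \<in> C then 0 else \<infinity>)"

definition stationary_point :: "('a::real_inner \<Rightarrow> real) \<Rightarrow> 'a set \<Rightarrow> 'a \<Rightarrow> bool" where
  "stationary_point f C w \<longleftrightarrow> w \<in> C
     \<and> 0 \<in> {grad f w + v | v. v \<in> limiting_subdiff (indicator_fun C) w}"


section \<open>Sparsity constraint and projected gradient map\<close>

definition l0norm :: "real^'n \<Rightarrow> nat" where
  "l0norm w = card {i. w $ i \<noteq> 0}"

definition sparse_set :: "nat \<Rightarrow> (real^'n) set" where
  "sparse_set s = {w. l0norm w \<le> s}"

definition coord_subspace :: "'n set \<Rightarrow> (real^'n) set" where
  "coord_subspace J = span ((\<lambda>j. axis j 1) ` J)"

text \<open>The Euclidean norm of the subvector of v with coordinates indexed by J.\<close>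
definition subvec_norm :: "'n set \<Rightarrow> real^'n \<Rightarrow> real" where
  "subvec_norm J v = L2_set (\<lambda>j. v $ j) J"

text \<open>Set-valued, because C need not be convex.\<close>
definition proj :: "'a::metric_space set \<Rightarrow> 'a \<Rightarrow> 'a set" where
  "proj C z = {x \<in> C. \<forall>y\<in>C. dist z x \<le> dist z y}"

definition T_PG :: "(real^'n \<Rightarrow> real) \<Rightarrow> nat \<Rightarrow> real \<Rightarrow> real^'n \<Rightarrow> (real^'n) set" where
  "T_PG f s lam w = proj (sparse_set s) (w - lam *\<^sub>R grad f w)"


section \<open>The accelerated projected gradient algorithm\<close>

text \<open>Throughout, v and w stand for two consecutive iterates (the previous and the current one),
  and d = w - v.\<close>

definition zeta :: "(real^'n \<Rightarrow> real) \<Rightarrow> 'n set \<Rightarrow> real^'n \<Rightarrow> real^'n \<Rightarrow> real" where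
  "zeta f J v w = - ((w - v) \<bullet> grad f w) / (norm (w - v) * subvec_norm J (grad f w))"

definition can_extrapolate ::
    "(real^'n \<Rightarrow> real) \<Rightarrow> nat \<Rightarrow> real \<Rightarrow> 'n set \<Rightarrow> real^'n \<Rightarrow> real^'n \<Rightarrow> bool" where
  "can_extrapolate f s eps J v w \<longleftrightarrow>
     card J = s \<and> v \<in> coord_subspace J \<and> w \<in> coord_subspace J
     \<and> norm (w - v) * subvec_norm J (grad f w) \<noteq> 0
     \<and> zeta f J v w \<ge> eps"

definition trial_BB :: "(real^'n \<Rightarrow> real) \<Rightarrow> real^'n \<Rightarrow> real^'n \<Rightarrow> ereal" where
  "trial_BB f v w =
     (let d = w - v; r = grad f w - grad f v; alpha = (d \<bullet> d) / (d \<bullet> r)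
      in if d \<bullet> r = 0 then \<infinity>
         else ereal (- (alpha * (grad f w \<bullet> d)) / (norm d)\<^sup>2))"

text \<open>H is the chosen element of the generalized Hessian at w.\<close>
definition trial_Newton ::
    "(real^'n \<Rightarrow> real) \<Rightarrow> real^'n^'n \<Rightarrow> real^'n \<Rightarrow> real^'n \<Rightarrow> ereal" where
  "trial_Newton f H v w =
     (let d = w - v
      in if (H *v d) \<bullet> d = 0 then \<infinity>
         else ereal (- (grad f w \<bullet> d) / ((H *v d) \<bullet> d)))"

definition trial_step ::
    "(real^'n \<Rightarrow> real) \<Rightarrow> real^'n \<Rightarrow> real^'n \<Rightarrow> ereal \<Rightarrow> bool" where
  "trial_step f v w t \<longleftrightarrow>
     t = trial_BB f v w \<or> (\<exists>H \<in> gen_hessian f w. t = trial_Newton f H v w)"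

text \<open>Projection of an extended real onto the real interval from a to b.\<close>
definition safeguard :: "real \<Rightarrow> real \<Rightarrow> ereal \<Rightarrow> real" where
  "safeguard a b t = (if t = \<infinity> then b else closest_point {a..b} (real_of_ereal t))"

definition sufficient_decrease ::
    "(real^'n \<Rightarrow> real) \<Rightarrow> real \<Rightarrow> real^'n \<Rightarrow> real^'n \<Rightarrow> real \<Rightarrow> bool" where
  "sufficient_decrease f sig w d t \<longleftrightarrow>
     f (w + t *\<^sub>R d) \<le> f w - sig * t\<^sup>2 * (norm d)\<^sup>2"

definition extrapolated ::
    "(real^'n \<Rightarrow> real) \<Rightarrow> real \<Rightarrow> real \<Rightarrow> real \<Rightarrow> real \<Rightarrow> 'n set
      \<Rightarrow> real^'n \<Rightarrow> real^'n \<Rightarrow> real^'n \<Rightarrow> bool" where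
  "extrapolated f eta sig amin amax J v w z \<longleftrightarrow>
     (let d = w - v; c = subvec_norm J (grad f w) / (zeta f J v w * norm d)
      in \<exists>t i. trial_step f v w t
           \<and> (let that = safeguard (c * amin) (c * amax) t
              in sufficient_decrease f sig w d (eta ^ i * that)
                 \<and> (\<forall>j<i. \<not> sufficient_decrease f sig w d (eta ^ j * that))
                 \<and> z = w + (eta ^ i * that) *\<^sub>R d))"

text \<open>A relation rather than a function: the choice of J, of the trial step formula, of the
  element of the generalized Hessian and of the projection may differ at every iteration.\<close>
definition APG_sequence ::
    "(real^'n \<Rightarrow> real) \<Rightarrow> nat \<Rightarrow> real \<Rightarrow> real \<Rightarrow> real \<Rightarrow> real \<Rightarrow> real \<Rightarrow> real
      \<Rightarrow> (nat \<Rightarrow> real^'n) \<Rightarrow> bool" where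
  "APG_sequence f s lam eps eta sig amin amax w \<longleftrightarrow>
     (\<forall>k. \<exists>z.
        (if k > 0 \<and> (\<exists>J. can_extrapolate f s eps J (w (k - 1)) (w k))
         then \<exists>J. can_extrapolate f s eps J (w (k - 1)) (w k)
                \<and> extrapolated f eta sig amin amax J (w (k - 1)) (w k) z
         else z = w k)
        \<and> w (Suc k) \<in> T_PG f s lam z)"

definition accumulation_point :: "(nat \<Rightarrow> 'a::topological_space) \<Rightarrow> 'a \<Rightarrow> bool" where
  "accumulation_point w x \<longleftrightarrow> (\<exists>r. strict_mono r \<and> (w \<circ> r) \<longlonglongrightarrow> x)"

end

theory Submission
  imports Defs
begin

text \<open>
  The function values decrease along the algorithm by an amount that controls the distance
  travelled. Both halves of an iteration contribute: the backtracking test makes the extrapolation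
  from \<open>w\<^sub>k\<close> to \<open>z\<^sub>k\<close> gain at least \<open>\<sigma> \<parallel>z\<^sub>k - w\<^sub>k\<parallel>\<^sup>2\<close>, and since
  \<open>\<lambda> < 1 / L\<close> the projected gradient step gains at least
  \<open>(1 / \<lambda> - L) / 2 \<cdot> \<parallel>w\<^sub>k\<^sub>+\<^sub>1 - z\<^sub>k\<parallel>\<^sup>2\<close> (lemma \<open>proj_gradient_decrease\<close>). As \<open>f\<close> is bounded
  below on the constraint set, which extrapolation does not leave because it moves inside a
  coordinate subspace spanned by \<open>s\<close> axes, the gains tend to zero, and so do \<open>z\<^sub>k - w\<^sub>k\<close> and
  \<open>w\<^sub>k\<^sub>+\<^sub>1 - z\<^sub>k\<close>.

  Hence along a subsequence with \<open>w\<^sub>k \<longlongrightarrow> w\<^sup>*\<close> also \<open>z\<^sub>k\<close> and \<open>w\<^sub>k\<^sub>+\<^sub>1\<close> tend to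
  \<open>w\<^sup>*\<close>. The projection onto a closed set has a closed graph (lemma \<open>proj_closed_graph\<close>), so
  \<open>w\<^sup>*\<close> is a nearest point of the constraint set to \<open>w\<^sup>* - \<lambda> \<nabla>f(w\<^sup>*)\<close>. Therefore \<open>- \<nabla>f(w\<^sup>*)\<close> is a
  proximal normal, and a fortiori a limiting normal, at \<open>w\<^sup>*\<close> (lemma
  \<open>proj_gradient_fixed_point_stationary\<close>).
\<close>

section \<open>The descent lemma\<close>

lemma gderiv_grad:
  fixes f :: "'a::euclidean_space \<Rightarrow> real"
  assumes "f differentiable (at x)"
  shows "GDERIV f x :> grad f x"
proof -
  obtain f' where f': "(f has_derivative f') (at x)"
    using assms unfolding differentiable_def by blast
  then have "linear f'" by (rule has_derivative_linear)
  then have "f' h = h \<bullet> adjoint f' 1" for h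
    using adjoint_works[of f' h 1] by simp
  then have "f' = (\<lambda>h. h \<bullet> adjoint f' 1)" by blast
  with f' have D: "GDERIV f x :> adjoint f' 1"
    unfolding gderiv_def by metis
  have "D' = adjoint f' 1" if "GDERIV f x :> D'" for D'
  proof -
    have "(\<lambda>h. h \<bullet> D') = (\<lambda>h. h \<bullet> adjoint f' 1)"
      using that D unfolding gderiv_def by (rule has_derivative_unique)
    then have "\<forall>h. h \<bullet> D' = h \<bullet> adjoint f' 1"
      by (rule fun_cong[THEN allI])
    then show ?thesis
      unfolding vector_eq_ldot .
  qed
  with D show ?thesis
    unfolding grad_def by (rule theI)
qed

text \<open>Along the segment from \<open>x\<close> to \<open>y\<close> the function minus its quadratic model has derivative
  \<open>(\<nabla>f(x + t d) - \<nabla>f(x)) \<bullet> d - L t \<parallel>d\<parallel>\<^sup>2\<close> with \<open>d = y - x\<close>, which the Lipschitz bound and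
  Cauchy-Schwarz make nonpositive.\<close>

lemma lipschitz_gradient_upper_bound:
  fixes f :: "'a::euclidean_space \<Rightarrow> real"
  assumes diff: "f differentiable_on UNIV" and lip: "L-lipschitz_on UNIV (grad f)"
  shows "f y \<le> f x + (y - x) \<bullet> grad f x + L / 2 * (norm (y - x))\<^sup>2"
proof -
  define d where "d = y - x"
  define \<phi> where "\<phi> t = f (x + t *\<^sub>R d) - t * (d \<bullet> grad f x) - L / 2 * t\<^sup>2 * (norm d)\<^sup>2" for t
  have "\<phi> 1 \<le> \<phi> 0"
  proof (rule DERIV_nonpos_imp_nonincreasing[of 0 1])
    fix t :: real assume t: "0 \<le> t" "t \<le> 1"
    have "(f has_derivative (\<lambda>h. h \<bullet> grad f (x + t *\<^sub>R d))) (at (x + t *\<^sub>R d))"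
      using gderiv_grad diff unfolding gderiv_def by (auto simp: differentiable_on_def)
    moreover have "((\<lambda>t. x + t *\<^sub>R d) has_derivative (\<lambda>h. h *\<^sub>R d)) (at t)"
      by (auto intro!: derivative_eq_intros)
    ultimately have "((\<lambda>t. f (x + t *\<^sub>R d)) has_derivative (\<lambda>h. h *\<^sub>R d \<bullet> grad f (x + t *\<^sub>R d))) (at t)"
      by (rule has_derivative_compose[rotated])
    then have *: "((\<lambda>t. f (x + t *\<^sub>R d)) has_real_derivative d \<bullet> grad f (x + t *\<^sub>R d)) (at t)"
      unfolding has_field_derivative_def by (simp add: mult.commute[of _ "d \<bullet> grad f (x + t *\<^sub>R d)"])
    have "DERIV \<phi> t :> d \<bullet> grad f (x + t *\<^sub>R d) - d \<bullet> grad f x - L * t * (norm d)\<^sup>2"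
      unfolding \<phi>_def by (rule derivative_eq_intros * refl)+ simp
    moreover have "d \<bullet> grad f (x + t *\<^sub>R d) - d \<bullet> grad f x \<le> L * t * (norm d)\<^sup>2"
    proof -
      have "d \<bullet> grad f (x + t *\<^sub>R d) - d \<bullet> grad f x = d \<bullet> (grad f (x + t *\<^sub>R d) - grad f x)"
        by (simp add: inner_diff_right)
      also have "\<dots> \<le> norm d * norm (grad f (x + t *\<^sub>R d) - grad f x)"
        by (rule norm_cauchy_schwarz)
      also have "\<dots> \<le> norm d * (L * (t * norm d))"
        using lipschitz_onD[OF lip, of "x + t *\<^sub>R d" x] t
        by (intro mult_left_mono) (auto simp: dist_norm)
      finally show ?thesis by (simp add: power2_eq_square mult_ac)
    qed
    ultimately show "\<exists>y. DERIV \<phi> t :> y \<and> y \<le> 0"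
      by (intro exI[of _ "d \<bullet> grad f (x + t *\<^sub>R d) - d \<bullet> grad f x - L * t * (norm d)\<^sup>2"]) simp
  qed simp
  then have "f (x + d) \<le> f x + d \<bullet> grad f x + L / 2 * (norm d)\<^sup>2"
    unfolding \<phi>_def by simp
  then show ?thesis
    unfolding d_def by simp
qed

section \<open>Projected gradient steps\<close>

text \<open>Comparing the nearest point with a point of the set and expanding the squares; the term
  \<open>(norm g)\<^sup>2\<close> cancels.\<close>

lemma proj_variational_inequality:
  fixes x y z g :: "'a::real_inner"
  assumes "x \<in> proj C (z - lam *\<^sub>R g)" and "y \<in> C"
  shows "(norm (x - z))\<^sup>2 + 2 * lam * ((x - z) \<bullet> g) \<le> (norm (y - z))\<^sup>2 + 2 * lam * ((y - z) \<bullet> g)"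
proof -
  have expand: "(dist (z - lam *\<^sub>R g) u)\<^sup>2
      = (norm (u - z))\<^sup>2 + 2 * lam * ((u - z) \<bullet> g) + (norm (lam *\<^sub>R g))\<^sup>2" for u
  proof -
    have "dist (z - lam *\<^sub>R g) u = norm ((u - z) + lam *\<^sub>R g)"
      by (subst dist_commute) (simp add: dist_norm algebra_simps)
    then show ?thesis
      using dot_norm[of "u - z" "lam *\<^sub>R g"] by simp
  qed
  have "(dist (z - lam *\<^sub>R g) x)\<^sup>2 \<le> (dist (z - lam *\<^sub>R g) y)\<^sup>2"
    using assms by (intro power_mono) (auto simp: proj_def)
  then show ?thesis unfolding expand by simp
qed

text \<open>The variational inequality at \<open>y = z\<close> bounds the linear term of the quadratic upper bound by
  \<open>- 1 / (2 * lam) * (norm (x - z))\<^sup>2\<close>. Comparison with \<open>z\<close> itself requires \<open>z\<close> to be feasible.\<close>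

lemma proj_gradient_decrease:
  fixes f :: "'a::euclidean_space \<Rightarrow> real"
  assumes "f differentiable_on UNIV" and "L-lipschitz_on UNIV (grad f)"
    and "0 < lam" and "z \<in> C" and "x \<in> proj C (z - lam *\<^sub>R grad f z)"
  shows "f x \<le> f z - (1 / lam - L) / 2 * (norm (x - z))\<^sup>2"
proof -
  define N where "N = (norm (x - z))\<^sup>2"
  have "N + 2 * lam * ((x - z) \<bullet> grad f z) \<le> 0"
    using proj_variational_inequality[OF assms(5,4)] by (simp add: N_def)
  with \<open>0 < lam\<close> have "(x - z) \<bullet> grad f z \<le> - (1 / lam / 2 * N)"
    by (simp add: field_simps)
  moreover have "f x \<le> f z + (x - z) \<bullet> grad f z + L / 2 * N"
    unfolding N_def by (rule lipschitz_gradient_upper_bound[OF assms(1,2)])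
  moreover have "(1 / lam - L) / 2 * N = 1 / lam / 2 * N - L / 2 * N"
    by (simp only: diff_divide_distrib left_diff_distrib)
  ultimately show ?thesis
    unfolding N_def by linarith
qed

lemma proj_closed_graph:
  fixes C :: "'a::metric_space set"
  assumes "closed C" and "\<And>k. x k \<in> proj C (u k)" and "x \<longlonglongrightarrow> x0" and "u \<longlonglongrightarrow> u0"
  shows "x0 \<in> proj C u0"
proof -
  have "x0 \<in> C"
    using assms closed_sequentially[of C x x0] by (auto simp: proj_def)
  moreover have "dist u0 x0 \<le> dist u0 y" if "y \<in> C" for y
  proof (rule LIMSEQ_le)
    show "(\<lambda>k. dist (u k) (x k)) \<longlonglongrightarrow> dist u0 x0" "(\<lambda>k. dist (u k) y) \<longlonglongrightarrow> dist u0 y"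
      using assms by (auto intro!: tendsto_intros)
    show "\<exists>N. \<forall>k\<ge>N. dist (u k) (x k) \<le> dist (u k) y"
      using assms(2) that by (auto simp: proj_def)
  qed
  ultimately show ?thesis by (simp add: proj_def)
qed

section \<open>Fixed points are stationary\<close>

lemma regular_subdiff_subset_limiting: "regular_subdiff h x \<subseteq> limiting_subdiff h x"
proof
  fix v assume v: "v \<in> regular_subdiff h x"
  then have "\<bar>h x\<bar> \<noteq> \<infinity>" by (simp add: regular_subdiff_def)
  with v show "v \<in> limiting_subdiff h x"
    unfolding limiting_subdiff_def
    by (intro CollectI conjI exI[of _ "\<lambda>_. x"] exI[of _ "\<lambda>_. v"]) simp_all
qed

text \<open>A proximal normal \<open>v\<close> satisfies a quadratic inequality on \<open>C\<close>, so the difference quotient in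
  the regular subdifferential is at least \<open>- c \<parallel>y - x\<parallel>\<close> on \<open>C\<close>, while off \<open>C\<close> it is infinite.\<close>

lemma proximal_normal_regular:
  fixes x v :: "'a::real_inner"
  assumes "x \<in> C" and prox: "\<And>y. y \<in> C \<Longrightarrow> v \<bullet> (y - x) \<le> c * (norm (y - x))\<^sup>2"
  shows "v \<in> regular_subdiff (indicator_fun C) x"
proof -
  define q where "q y = (indicator_fun C y - indicator_fun C x - ereal (v \<bullet> (y - x)))
    / ereal (norm (y - x))" for y
  have lower: "ereal (- (c * norm (y - x))) \<le> q y" if "y \<noteq> x" for y
  proof (cases "y \<in> C")
    case True
    have "- (c * norm (y - x)) \<le> - (v \<bullet> (y - x)) / norm (y - x)"
      using prox[OF True] that by (simp add: field_simps power2_eq_square)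
    then show ?thesis
      using True assms(1) that by (simp add: q_def indicator_fun_def)
  next
    case False
    then show ?thesis
      using assms(1) that by (simp add: q_def indicator_fun_def)
  qed
  have lim: "((\<lambda>y. ereal (- (c * norm (y - x)))) \<longlongrightarrow> ereal (- (c * norm (x - x)))) (at x)"
    by (intro tendsto_intros)
  \<comment> \<open>The filter \<open>at x\<close> is trivial when the whole space is a single point.\<close>
  have "0 \<le> Liminf (at x) q"
  proof (cases "at x = bot")
    case False
    have "0 = Liminf (at x) (\<lambda>y. ereal (- (c * norm (y - x))))"
      using lim_imp_Liminf[OF False lim] by (simp add: zero_ereal_def)
    also have "\<dots> \<le> Liminf (at x) q"
      using lower by (intro Liminf_mono) (auto simp: eventually_at_filter)
    finally show ?thesis .
  qed (auto intro: Liminf_bounded)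
  then show ?thesis
    using assms(1) unfolding q_def by (simp add: regular_subdiff_def) (simp add: indicator_fun_def)
qed

lemma proj_gradient_fixed_point_stationary:
  assumes "0 < lam" and fp: "x \<in> proj C (x - lam *\<^sub>R grad f x)"
  shows "stationary_point f C x"
proof -
  have "x \<in> C" using fp by (simp add: proj_def)
  have "(- grad f x) \<bullet> (y - x) \<le> 1 / (2 * lam) * (norm (y - x))\<^sup>2" if "y \<in> C" for y
    using proj_variational_inequality[OF fp that] \<open>0 < lam\<close>
    by (simp add: inner_commute field_simps)
  from proximal_normal_regular[OF \<open>x \<in> C\<close> this]
  have "- grad f x \<in> limiting_subdiff (indicator_fun C) x"
    using regular_subdiff_subset_limiting by blast
  with \<open>x \<in> C\<close> show ?thesis
    unfolding stationary_point_def by (force intro: exI[of _ "- grad f x"])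
qed

section \<open>The sparsity constraint\<close>

text \<open>As a finite union of coordinate subspaces the constraint set is closed, although the
  \<open>l0norm\<close> is only lower semicontinuous.\<close>

lemma sparse_set_eq_Union:
  "sparse_set s = (\<Union>J\<in>{J. card J \<le> s}. {w::real^'n. \<forall>i\<in>-J. w $ i = 0})"
proof -
  have "l0norm w \<le> s \<longleftrightarrow> (\<exists>J. card J \<le> s \<and> (\<forall>i\<in>-J. w $ i = 0))" for w :: "real^'n"
  proof
    assume "l0norm w \<le> s"
    then show "\<exists>J. card J \<le> s \<and> (\<forall>i\<in>-J. w $ i = 0)"
      unfolding l0norm_def by (intro exI[of _ "{i. w $ i \<noteq> 0}"]) simp
  next
    assume "\<exists>J. card J \<le> s \<and> (\<forall>i\<in>-J. w $ i = 0)"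
    then obtain J where J: "card J \<le> s" "{i. w $ i \<noteq> 0} \<subseteq> J" by blast
    then have "l0norm w \<le> card J"
      unfolding l0norm_def by (intro card_mono) auto
    with J(1) show "l0norm w \<le> s" by simp
  qed
  then show ?thesis
    unfolding sparse_set_def by auto
qed

lemma closed_sparse_set: "closed (sparse_set s :: (real^'n) set)"
proof -
  have "{w::real^'n. \<forall>i\<in>-J. w $ i = 0} = (\<Inter>i\<in>-J. {w. w $ i = 0})" for J
    by auto
  then have "closed {w::real^'n. \<forall>i\<in>-J. w $ i = 0}" for J
    by (simp add: closed_INT closed_Collect_eq continuous_on_component)
  then show ?thesis
    unfolding sparse_set_eq_Union by (intro closed_UN) auto
qed

lemma coord_subspace_subset_sparse_set:
  fixes J :: "'n::finite set"
  assumes "card J \<le> s"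
  shows "coord_subspace J \<subseteq> sparse_set s"
proof -
  have "coord_subspace J \<subseteq> {w::real^'n. \<forall>i\<in>-J. w $ i = 0}"
    unfolding coord_subspace_def
    by (intro span_minimal subspaceI) (auto simp: axis_def)
  with assms show ?thesis
    unfolding sparse_set_eq_Union by blast
qed

section \<open>Convergence of the accelerated algorithm\<close>

lemma extrapolated_step:
  assumes "can_extrapolate f s eps J v w" and "extrapolated f eta sig amin amax J v w z"
  shows "z \<in> sparse_set s" and "f z \<le> f w - sig * (norm (z - w))\<^sup>2"
proof -
  obtain t where z: "z = w + t *\<^sub>R (w - v)" and dec: "sufficient_decrease f sig w (w - v) t"
    using assms(2) unfolding extrapolated_def Let_def by (elim exE conjE) (rule that)
  have "z \<in> coord_subspace J"
    using assms(1) unfolding z can_extrapolate_def coord_subspace_def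
    by (intro span_add span_mul span_diff) auto
  then show "z \<in> sparse_set s"
    using assms(1) coord_subspace_subset_sparse_set[of J s] by (auto simp: can_extrapolate_def)
  show "f z \<le> f w - sig * (norm (z - w))\<^sup>2"
    using dec by (simp add: z sufficient_decrease_def power_mult_distrib)
qed

text \<open>The iterate \<open>w 0\<close> may violate the constraint, in which case the first projection can increase
  \<open>f\<close>; from \<open>w 1\<close> on all iterates are feasible.\<close>

lemma APG_step_decrease:
  fixes f :: "real^'n \<Rightarrow> real"
  assumes diff: "f differentiable_on UNIV" and lip: "L-lipschitz_on UNIV (grad f)"
    and lam: "0 < lam" and apg: "APG_sequence f s lam eps eta sig amin amax w"
  obtains z where "\<And>k. w (Suc k) \<in> T_PG f s lam (z k)"
    and "\<And>k. 0 < k \<Longrightarrow> f (w (Suc k)) + sig * (norm (z k - w k))\<^sup>2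
      + (1 / lam - L) / 2 * (norm (w (Suc k) - z k))\<^sup>2 \<le> f (w k)"
proof -
  obtain z where z:
    "\<forall>k. (if k > 0 \<and> (\<exists>J. can_extrapolate f s eps J (w (k - 1)) (w k))
         then \<exists>J. can_extrapolate f s eps J (w (k - 1)) (w k)
                \<and> extrapolated f eta sig amin amax J (w (k - 1)) (w k) (z k)
         else z k = w k)
        \<and> w (Suc k) \<in> T_PG f s lam (z k)"
    using apg[unfolded APG_sequence_def, THEN choice] by (rule exE)
  then have step: "w (Suc k) \<in> T_PG f s lam (z k)" for k
    by simp
  have feasible: "w (Suc k) \<in> sparse_set s" for k
    using step[of k] by (simp add: T_PG_def proj_def)
  have "z k \<in> sparse_set s \<and> f (z k) \<le> f (w k) - sig * (norm (z k - w k))\<^sup>2" if "0 < k" for k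
  proof (cases "\<exists>J. can_extrapolate f s eps J (w (k - 1)) (w k)")
    case True
    with z[THEN spec, of k] that obtain J where "can_extrapolate f s eps J (w (k - 1)) (w k)"
      and "extrapolated f eta sig amin amax J (w (k - 1)) (w k) (z k)"
      by (simp only: if_True simp_thms) blast
    then show ?thesis by (intro conjI extrapolated_step)
  next
    case False
    with z have "z k = w k" by (auto dest!: spec[of _ k])
    with feasible[of "k - 1"] that show ?thesis by simp
  qed
  moreover have "f (w (Suc k)) \<le> f (z k) - (1 / lam - L) / 2 * (norm (w (Suc k) - z k))\<^sup>2"
    if "z k \<in> sparse_set s" for k
    using step[of k] unfolding T_PG_def by (rule proj_gradient_decrease[OF diff lip lam that])
  ultimately have "f (w (Suc k)) + sig * (norm (z k - w k))\<^sup>2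
      + (1 / lam - L) / 2 * (norm (w (Suc k) - z k))\<^sup>2 \<le> f (w k)" if "0 < k" for k
    using that by (smt (verit))
  with step show ?thesis by (rule that)
qed

text \<open>Being decreasing and bounded below, \<open>a\<close> converges, so its consecutive differences, which
  dominate \<open>g\<close>, tend to zero.\<close>

lemma telescoping_gaps_vanish:
  fixes a :: "nat \<Rightarrow> real"
  assumes lower: "\<And>k. m \<le> a k" and dec: "\<And>k. a (Suc k) + g k \<le> a k" and nonneg: "\<And>k. 0 \<le> g k"
  shows "g \<longlonglongrightarrow> 0"
proof -
  have "decseq a"
    using dec nonneg by (intro decseq_SucI) (smt (verit))
  then obtain l where "a \<longlonglongrightarrow> l"
    using decseq_convergent[of a m] lower by blast
  then have "(\<lambda>k. a k - a (Suc k)) \<longlonglongrightarrow> l - l"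
    by (intro tendsto_diff LIMSEQ_Suc)
  then have "(\<lambda>k. a k - a (Suc k)) \<longlonglongrightarrow> 0" by simp
  moreover have "g k \<le> a k - a (Suc k)" for k
    using dec[of k] by simp
  ultimately show ?thesis
    using tendsto_sandwich[of "\<lambda>_. 0" g sequentially "\<lambda>k. a k - a (Suc k)" 0] nonneg by simp
qed

lemma tendsto_zero_of_square_le:
  fixes x :: "nat \<Rightarrow> 'a::real_normed_vector"
  assumes "0 < c" and "\<And>k. c * (norm (x k))\<^sup>2 \<le> g k" and "g \<longlonglongrightarrow> 0"
  shows "x \<longlonglongrightarrow> 0"
proof -
  have "(\<lambda>k. g k / c) \<longlonglongrightarrow> 0"
    using tendsto_divide[OF assms(3) tendsto_const, of c] assms(1) by simp
  then have "(\<lambda>k. (norm (x k))\<^sup>2) \<longlonglongrightarrow> 0"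
    by (rule tendsto_sandwich[OF _ _ tendsto_const, rotated 2])
      (use assms in \<open>auto simp: field_simps\<close>)
  then have "(\<lambda>k. sqrt ((norm (x k))\<^sup>2)) \<longlonglongrightarrow> sqrt 0"
    by (rule tendsto_real_sqrt)
  then show ?thesis by (simp add: tendsto_norm_zero_iff)
qed

theorem theorem3p1:
  fixes f :: "real^'n \<Rightarrow> real" and s :: nat
    and L lam eps eta sig amin amax :: real
    and w :: "nat \<Rightarrow> real^'n" and wstar :: "real^'n"
  assumes "L > 0"
    and "f differentiable_on UNIV"
    and "L-lipschitz_on UNIV (grad f)"
    and "bdd_below (f ` sparse_set s)"
    and "0 < lam" "lam < inverse L"
    and "0 < eps" "eps < 1"
    and "0 < eta" "eta < 1"
    and "0 < sig" "sig < 1"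
    and "0 < amin" "amin \<le> amax"
    and "APG_sequence f s lam eps eta sig amin amax w"
    and "accumulation_point w wstar"
  shows "stationary_point f (sparse_set s) wstar"
proof -
  obtain z where step: "\<And>k. w (Suc k) \<in> T_PG f s lam (z k)"
    and dec: "\<And>k. 0 < k \<Longrightarrow> f (w (Suc k)) + sig * (norm (z k - w k))\<^sup>2
      + (1 / lam - L) / 2 * (norm (w (Suc k) - z k))\<^sup>2 \<le> f (w k)"
    using APG_step_decrease[OF assms(2,3,5,15)] by blast
  define c where "c = (1 / lam - L) / 2"
  define g where "g k = sig * (norm (z (Suc k) - w (Suc k)))\<^sup>2
      + c * (norm (w (Suc (Suc k)) - z (Suc k)))\<^sup>2" for k
  have c: "0 < c"
    using assms(1,5,6) by (simp add: c_def field_simps)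
  obtain m where m: "\<And>v. v \<in> sparse_set s \<Longrightarrow> m \<le> f v"
    using assms(4) by (auto simp: bdd_below_def)
  have "g \<longlonglongrightarrow> 0"
  proof (rule telescoping_gaps_vanish[of m "\<lambda>k. f (w (Suc k))"])
    show "m \<le> f (w (Suc k))" for k
      using step[of k] by (intro m) (simp add: T_PG_def proj_def)
    show "f (w (Suc (Suc k))) + g k \<le> f (w (Suc k))" for k
      using dec[of "Suc k"] by (simp add: g_def c_def add.assoc)
    show "0 \<le> g k" for k
      using assms(11) c by (simp add: g_def)
  qed
  then have "(\<lambda>k. z (Suc k) - w (Suc k)) \<longlonglongrightarrow> 0" "(\<lambda>k. w (Suc (Suc k)) - z (Suc k)) \<longlonglongrightarrow> 0"
    using assms(11) c
    by (auto intro: tendsto_zero_of_square_le[of sig _ g] tendsto_zero_of_square_le[of c _ g]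
        simp: g_def)
  then have gaps: "(\<lambda>k. z k - w k) \<longlonglongrightarrow> 0" "(\<lambda>k. w (Suc k) - z k) \<longlonglongrightarrow> 0"
    by (auto dest: LIMSEQ_imp_Suc)
  obtain r where r: "strict_mono r" "(\<lambda>k. w (r k)) \<longlonglongrightarrow> wstar"
    using assms(16) by (auto simp: accumulation_point_def o_def)
  have zr: "(\<lambda>k. z (r k)) \<longlonglongrightarrow> wstar"
    using tendsto_add[OF LIMSEQ_subseq_LIMSEQ[OF gaps(1) r(1)] r(2)] by (simp add: o_def)
  have wr: "(\<lambda>k. w (Suc (r k))) \<longlonglongrightarrow> wstar"
    using tendsto_add[OF LIMSEQ_subseq_LIMSEQ[OF gaps(2) r(1)] zr] by (simp add: o_def)
  have "isCont (grad f) wstar"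
    using lipschitz_on_continuous_on[OF assms(3)] by (simp add: continuous_on_eq_continuous_at)
  then have "(\<lambda>k. z (r k) - lam *\<^sub>R grad f (z (r k))) \<longlonglongrightarrow> wstar - lam *\<^sub>R grad f wstar"
    using zr by (intro tendsto_intros isCont_tendsto_compose[of _ "grad f"])
  with closed_sparse_set _ wr
  have "wstar \<in> proj (sparse_set s) (wstar - lam *\<^sub>R grad f wstar)"
    by (rule proj_closed_graph) (use step in \<open>simp add: T_PG_def\<close>)
  with assms(5) show ?thesis
    by (rule proj_gradient_fixed_point_stationary)
qed

end
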